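(* For all integers $c\geq 2$ and $d\geq 2$ there is a finite family $\mathcal{F}$ of subsets of $\mathbb{R}^d$ with $TC_\infty(\mathcal{F})=0$ and Carathéodory number $c(\mathcal{F})=c$.
   Context: For a finite family $\mathcal{F}$ of subsets of $X$ and $S\subseteq X$, $\operatorname{conv}_{\mathcal{F}}(S)$ is the intersection of all members of $\mathcal{F}$ containing $S$, and equals $X$ if no member contains $S$. The Carathéodory number $c(\mathcal{F})$ is the smallest integer $c$ such that for every $S\subseteq X$ and every $x\in\operatorname{conv}_{\mathcal{F}}(S)$ there is $S'\subseteq S$ with $|S'|\leq c$ and $x\in\operatorname{conv}_{\mathcal{F}}(S')$ ($c(\mathcal{F})=\infty$ if none exists). The full topological complexity is $TC_\infty(\mathcal{F})=\sup\{\widetilde\beta_i(\bigcap\mathcal{G};\mathbb{Z}_2)\colon \mathcal{G}\subseteq\mathcal{F},\ i\geq 0\}$, where $\widetilde\beta_i(\cdot;\mathbb{Z}_2)$ is the $i$-th reduced Betti number with $\mathbb{Z}_2$ coefficients. *)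

theory Defs
  imports "HOL-Homology.Homology" "HOL-Library.Z2" "HOL-Library.Extended_Nat"
begin

section \<open>Reduced singular homology with coefficients in the field \<^typ>\<open>bit\<close>\<close>

text \<open>The integral chains of \<^theory>\<open>HOL-Homology.Simplices\<close> with \<^typ>\<open>int\<close> replaced by the
  two-element field; the signs in the boundary map disappear in characteristic 2.\<close>

type_synonym 'a chain2 = "((nat \<Rightarrow> real) \<Rightarrow> 'a) \<Rightarrow>\<^sub>0 bit"

definition singular_chain2_set :: "nat \<Rightarrow> 'a topology \<Rightarrow> 'a chain2 set" where
  "singular_chain2_set p X = {c. Poly_Mapping.keys c \<subseteq> singular_simplex_set p X}"

definition chain2_boundary :: "nat \<Rightarrow> 'a chain2 \<Rightarrow> 'a chain2" where
  "chain2_boundary p c =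
     (if p = 0 then 0
      else \<Sum>f\<in>Poly_Mapping.keys c. \<Sum>k\<le>p.
             Poly_Mapping.single (singular_face p k f) (Poly_Mapping.lookup c f))"

definition chain2_augmentation :: "'a chain2 \<Rightarrow> bit" where
  "chain2_augmentation c = (\<Sum>f\<in>Poly_Mapping.keys c. Poly_Mapping.lookup c f)"

text \<open>Cycles of the augmented chain complex: in degree 0 the boundary map is the augmentation.\<close>

definition reduced_cycle2_set :: "nat \<Rightarrow> 'a topology \<Rightarrow> 'a chain2 set" where
  "reduced_cycle2_set p X =
     {c \<in> singular_chain2_set p X.
        if p = 0 then chain2_augmentation c = 0 else chain2_boundary p c = 0}"

definition boundary2_set :: "nat \<Rightarrow> 'a topology \<Rightarrow> 'a chain2 set" where
  "boundary2_set p X = chain2_boundary (Suc p) ` singular_chain2_set (Suc p) X"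

definition reduced_cycle2_group :: "nat \<Rightarrow> 'a topology \<Rightarrow> 'a chain2 monoid" where
  "reduced_cycle2_group p X = \<lparr>carrier = reduced_cycle2_set p X, monoid.mult = (+), one = 0\<rparr>"

definition reduced_homology2_group :: "nat \<Rightarrow> 'a topology \<Rightarrow> 'a chain2 set monoid" where
  "reduced_homology2_group p X = reduced_cycle2_group p X Mod boundary2_set p X"

text \<open>A commutative group of exponent 2, written multiplicatively, is a vector space over the
  two-element field in a unique way. A linear combination of the elements of a finite set \<open>C\<close> is
  the product of a subset of \<open>C\<close>, namely of the elements with coefficient 1.\<close>

definition Z2_independent :: "('g, 'm) monoid_scheme \<Rightarrow> 'g set \<Rightarrow> bool" where
  "Z2_independent G C \<longleftrightarrow> finite C \<and> C \<subseteq> carrier G \<and>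
     (\<forall>D\<subseteq>C. finprod G (\<lambda>x. x) D = \<one>\<^bsub>G\<^esub> \<longrightarrow> D = {})"

definition Z2_dim :: "('g, 'm) monoid_scheme \<Rightarrow> enat" where
  "Z2_dim G = Sup {enat (card C) | C. Z2_independent G C}"

definition reduced_betti2 :: "nat \<Rightarrow> 'a topology \<Rightarrow> enat" where
  "reduced_betti2 i X = Z2_dim (reduced_homology2_group i X)"

section \<open>Set families\<close>

text \<open>The ground set is the whole type. By \<open>\<Inter>{} = UNIV\<close>, the hull of \<open>S\<close> is the ground set if no
  member of the family contains \<open>S\<close>, and the empty subfamily has the ground set as intersection.\<close>

definition TC_infinity :: "'a::topological_space set set \<Rightarrow> enat" where
  "TC_infinity F = Sup {reduced_betti2 i (top_of_set (\<Inter>G)) | G i. G \<subseteq> F}"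

definition family_conv :: "'a set set \<Rightarrow> 'a set \<Rightarrow> 'a set" where
  "family_conv F S = \<Inter>{A \<in> F. S \<subseteq> A}"

text \<open>The infimum of the empty set in \<^typ>\<open>enat\<close> is \<open>\<infinity>\<close>.\<close>

definition caratheodory_number :: "'a set set \<Rightarrow> enat" where
  "caratheodory_number F =
     Inf {enat c | c. \<forall>S. \<forall>x\<in>family_conv F S.
            \<exists>S'\<subseteq>S. finite S' \<and> card S' \<le> c \<and> x \<in> family_conv F S'}"

end

theory Submission
  imports Defs
begin

text \<open>Take \<open>c\<close> distinct lines through the origin in a plane, with a nonzero point \<open>p\<^sub>i\<close> on the
  \<open>i\<close>-th line, and let \<open>A\<^sub>i\<close> be the union of all lines but the \<open>i\<close>-th. Intersections of the
  \<open>A\<^sub>i\<close> are star-shaped about the origin, hence acyclic. No \<open>A\<^sub>i\<close> contains all of the \<open>p\<^sub>j\<close>, so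
  their hull is the whole space, while every \<open>c - 1\<close> of them lie in a common \<open>A\<^sub>i\<close> and so do not
  capture a point off the lines. Conversely, a family of \<open>c\<close> sets has Caratheodory number at most
  \<open>c\<close>: for each member not containing \<open>S\<close> keep one point of \<open>S\<close> outside it.

  Acyclicity over the two-element field is deduced from integral acyclicity as in the universal
  coefficient theorem: if \<open>z\<close> is a cycle modulo 2, then \<open>\<partial>z = 2d\<close> for an integral cycle \<open>d = \<partial>e\<close>, so
  \<open>z - 2e\<close> is an integral cycle congruent to \<open>z\<close>.\<close>

section \<open>Integral chains of contractible spaces\<close>

text \<open>The integral augmentation, matching \<open>chain2_augmentation\<close>.\<close>

definition frag_total :: "('a \<Rightarrow>\<^sub>0 int) \<Rightarrow> int" where
  "frag_total c = (\<Sum>f\<in>Poly_Mapping.keys c. Poly_Mapping.lookup c f)"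

lemma frag_extend_const: "frag_extend (\<lambda>_. frag_of s) c = frag_cmul (frag_total c) (frag_of s)"
  by (rule poly_mapping_eqI)
    (simp add: frag_extend_def frag_total_def lookup_sum sum_distrib_right)

text \<open>Factoring through the free group on one generator lets linearity be inherited from
  \<open>frag_extend\<close>.\<close>

lemma frag_total_eq: "frag_total c = Poly_Mapping.lookup (frag_extend (\<lambda>_. frag_of ()) c) ()"
  by (simp add: frag_extend_const)

lemma frag_total_of [simp]: "frag_total (frag_of f) = 1"
  by (simp add: frag_total_eq)

lemma frag_total_0 [simp]: "frag_total 0 = 0"
  by (simp add: frag_total_eq)

lemma frag_total_diff: "frag_total (a - b) = frag_total a - frag_total b"
  by (simp add: frag_total_eq frag_extend_diff lookup_minus)

lemma frag_total_cmul: "frag_total (frag_cmul k a) = k * frag_total a"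
  by (simp add: frag_total_eq frag_extend_cmul)

text \<open>The two faces of a 1-simplex enter its boundary with opposite signs; linearity does the
  rest.\<close>

lemma frag_total_chain_boundary: "frag_total (chain_boundary (Suc 0) c) = 0"
proof -
  have "c \<in> {c. Poly_Mapping.keys c \<subseteq> UNIV \<and> frag_total (chain_boundary (Suc 0) c) = 0}"
    by (rule frag_induction[where S = UNIV])
      (auto simp: chain_boundary_of chain_boundary_diff frag_total_diff)
  then show ?thesis by simp
qed

definition reduced_cycle :: "nat \<Rightarrow> 'a topology \<Rightarrow> 'a chain \<Rightarrow> bool" where
  "reduced_cycle p X c \<longleftrightarrow>
     singular_chain p X c \<and> (if p = 0 then frag_total c = 0 else chain_boundary p c = 0)"

lemma contractible_reduced_cycle_is_boundary:
  assumes X: "contractible_space X" and c: "reduced_cycle p X c"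
  shows "\<exists>d. singular_chain (Suc p) X d \<and> chain_boundary (Suc p) d = c"
proof -
  have cyc: "singular_relcycle p X {} c"
    using c by (cases "p = 0") (auto simp: reduced_cycle_def singular_relcycle chain_boundary_def)
  have "singular_relboundary p X {} c"
  proof (cases "p = 0")
    case True
    \<comment> \<open>Contracting to the point \<open>a\<close> makes \<open>c\<close> homologous to
      its image under a constant map. That image is \<open>frag_total c\<close> times one constant
      simplex, hence 0.\<close>
    obtain a where "homotopic_with (\<lambda>_. True) X X id (\<lambda>_. a)"
      using X by (auto simp: contractible_space_def)
    then have "homologous_rel p X {} (chain_map p id c) (chain_map p (\<lambda>_. a) c)"
      using cyc by (intro homotopic_imp_homologous_rel_chain_maps) auto
    moreover have "chain_map p id c = c"
      using c chain_map_ident[of p X c] by (simp only: reduced_cycle_def)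
    moreover have "chain_map p (\<lambda>_. a) c = 0"
    proof -
      have "chain_map p (\<lambda>_. a) c = frag_extend (\<lambda>_. frag_of (\<lambda>x\<in>standard_simplex p. a)) c"
        unfolding chain_map_def by (rule frag_extend_eq) (simp add: simplex_map_def o_def)
      also have "\<dots> = frag_cmul (frag_total c) (frag_of (\<lambda>x\<in>standard_simplex p. a))"
        by (rule frag_extend_const)
      finally show ?thesis
        using True c by (simp add: reduced_cycle_def)
    qed
    ultimately show ?thesis by (simp add: homologous_rel_def)
  next
    case False
    \<comment> \<open>In positive degree reduced and unreduced homology agree, so the class of every
      cycle is the set of boundaries; \<open>c\<close> lies in its own class.\<close>
    then have "trivial_group (homology_group (int p) X)"
      using trivial_reduced_homology_group_contractible_space[OF X, of "int p"]
      by (simp add: un_reduced_homology_group)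
    then have "homologous_rel_set p X {} ` singular_relcycle_set p X {}
                 = {singular_relboundary_set p X {}}"
      by (simp add: trivial_group_def carrier_relative_homology_group one_relative_homology_group)
    then have "homologous_rel_set p X {} c = singular_relboundary_set p X {}"
      using cyc by (metis imageI mem_Collect_eq singletonD)
    then show ?thesis
      by (metis homologous_rel_refl mem_Collect_eq)
  qed
  then show ?thesis
    by (auto simp: singular_relboundary_def mod_subset_def singular_chain_empty)
qed

section \<open>Reduction modulo 2\<close>

definition reduce2 :: "('a \<Rightarrow>\<^sub>0 int) \<Rightarrow> ('a \<Rightarrow>\<^sub>0 bit)" where
  "reduce2 = Poly_Mapping.map of_int"

lemma lookup_reduce2 [simp]: "Poly_Mapping.lookup (reduce2 c) f = of_int (Poly_Mapping.lookup c f)"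
  by (simp add: reduce2_def map.rep_eq when_def)

lemma reduce2_0 [simp]: "reduce2 0 = 0"
  by (rule poly_mapping_eqI) simp

lemma reduce2_add: "reduce2 (a + b) = reduce2 a + reduce2 b"
  by (rule poly_mapping_eqI) (simp add: lookup_add)

lemma reduce2_diff: "reduce2 (a - b) = reduce2 a - reduce2 b"
  by (rule poly_mapping_eqI) (simp add: lookup_minus del: minus_bit_def)

lemma reduce2_sum: "reduce2 (sum g I) = (\<Sum>i\<in>I. reduce2 (g i))"
  by (induction I rule: infinite_finite_induct) (simp_all add: reduce2_add)

lemma reduce2_cmul_of:
  "reduce2 (frag_cmul k (frag_of s)) = Poly_Mapping.single s (of_int k)"
  by (rule poly_mapping_eqI) (simp add: lookup_single when_def)

lemma reduce2_cmul_2 [simp]: "reduce2 (frag_cmul 2 a) = 0"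
  by (rule poly_mapping_eqI) simp

lemma of_int_bit_eq_0_iff: "(of_int k :: bit) = 0 \<longleftrightarrow> even k"
proof -
  have "of_int (2 * m) = (0 :: bit)" "of_int (2 * m + 1) = (1 :: bit)" for m
    by simp_all
  then show ?thesis
    by (metis evenE oddE zero_neq_one)
qed

lemma keys_reduce2: "Poly_Mapping.keys (reduce2 c) \<subseteq> Poly_Mapping.keys c"
  by (auto simp: in_keys_iff)

text \<open>Lift the coefficients to the integers 0 and 1. The bound on the keys keeps the lift of a
  chain of a space inside that space.\<close>

lemma ex_reduce2: "\<exists>a. reduce2 a = c \<and> Poly_Mapping.keys a \<subseteq> Poly_Mapping.keys c"
proof (intro exI conjI)
  let ?a = "Poly_Mapping.map (\<lambda>b :: bit. of_bool (b \<noteq> 0) :: int) c"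
  show "reduce2 ?a = c"
    by (rule poly_mapping_eqI) (auto simp: map.rep_eq when_def)
  show "Poly_Mapping.keys ?a \<subseteq> Poly_Mapping.keys c"
    by (auto simp: in_keys_iff map.rep_eq when_def split: if_splits)
qed

lemma reduce2_eq_0_imp_cmul_2:
  assumes "reduce2 c = 0"
  shows "\<exists>d. c = frag_cmul 2 d"
proof
  have "even (Poly_Mapping.lookup c f)" for f
    using assms lookup_reduce2[of c f] by (simp add: of_int_bit_eq_0_iff)
  then show "c = frag_cmul 2 (Poly_Mapping.map (\<lambda>k. k div 2) c)"
    by (intro poly_mapping_eqI) (simp add: map.rep_eq when_def)
qed

lemma chain2_augmentation_reduce2: "chain2_augmentation (reduce2 c) = of_int (frag_total c)"
proof -
  have "chain2_augmentation (reduce2 c) = (\<Sum>f\<in>Poly_Mapping.keys c. of_int (Poly_Mapping.lookup c f))"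
    \<comment> \<open>Simplices with even coefficient leave the support under reduction, but
      contribute 0 to the sum, so they may be put back.\<close>
    unfolding chain2_augmentation_def lookup_reduce2
    by (intro sum.mono_neutral_left finite_keys keys_reduce2) (auto simp: in_keys_iff)
  then show ?thesis by (simp add: frag_total_def)
qed

lemma chain2_boundary_reduce2: "chain2_boundary p (reduce2 c) = reduce2 (chain_boundary p c)"
proof (cases "p = 0")
  case False
  \<comment> \<open>Powers of -1 are odd, so the signs of the integral boundary become 1 modulo
    2.\<close>
  have sign: "of_int (l * (-1) ^ k) = (of_int l :: bit)" for l k
  proof -
    have "of_int ((-1) ^ k) = (1 :: bit)"
      by (metis bit_not_zero_iff of_int_bit_eq_0_iff even_power even_minus odd_one)
    then show ?thesis by (simp only: of_int_mult mult_1_right)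
  qed
  have "chain2_boundary p (reduce2 c)
      = (\<Sum>f\<in>Poly_Mapping.keys c. \<Sum>k\<le>p.
           Poly_Mapping.single (singular_face p k f) (of_int (Poly_Mapping.lookup c f)))"
    unfolding chain2_boundary_def lookup_reduce2 if_not_P[OF False]
    by (intro sum.mono_neutral_left finite_keys keys_reduce2) (auto simp: in_keys_iff)
  also have "\<dots> = reduce2 (chain_boundary p c)"
    using False
    by (simp add: chain_boundary_def frag_extend_def reduce2_sum frag_cmul_sum reduce2_cmul_of
        sign del: of_int_mult of_int_power)
  finally show ?thesis .
qed (simp add: chain2_boundary_def chain_boundary_def)

lemma singular_chain2_reduce2:
  "singular_chain p X c \<Longrightarrow> reduce2 c \<in> singular_chain2_set p X"
  using keys_reduce2[of c] by (auto simp: singular_chain_def singular_chain2_set_def)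

lemma singular_chain2_lift:
  assumes "c \<in> singular_chain2_set p X"
  obtains a where "singular_chain p X a" "reduce2 a = c"
  using assms ex_reduce2[of c] by (auto simp: singular_chain_def singular_chain2_set_def)

lemma boundary2_set_eq:
  "boundary2_set p X = (\<lambda>a. reduce2 (chain_boundary (Suc p) a)) ` singular_chain_set (Suc p) X"
proof -
  have "singular_chain2_set (Suc p) X = reduce2 ` singular_chain_set (Suc p) X"
    by (auto intro: singular_chain2_reduce2 elim!: singular_chain2_lift)
  then show ?thesis
    by (simp add: boundary2_set_def image_image chain2_boundary_reduce2)
qed

lemma singular_chain_cmulD:
  "singular_chain p X (frag_cmul k d) \<Longrightarrow> k \<noteq> 0 \<Longrightarrow> singular_chain p X d"
  by (auto simp: singular_chain_def)

lemma reduced_cycle2_lift: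
  assumes X: "contractible_space X" and c: "c \<in> reduced_cycle2_set p X"
  shows "\<exists>a. reduced_cycle p X a \<and> reduce2 a = c"
proof -
  obtain a where a: "singular_chain p X a" "reduce2 a = c"
    using c by (auto simp: reduced_cycle2_set_def elim: singular_chain2_lift)
  \<comment> \<open>Subtracting twice a chain does not change the reduction modulo 2, so such an
    \<open>e\<close> corrects \<open>a\<close> to the desired lift.\<close>
  have "\<exists>e. singular_chain p X e \<and> reduced_cycle p X (a - frag_cmul 2 e)"
  proof (cases p)
    case 0
    then have "even (frag_total a)"
      using c a by (auto simp: reduced_cycle2_set_def chain2_augmentation_reduce2 of_int_bit_eq_0_iff)
    then obtain k where k: "frag_total a = 2 * k" by blast
    show ?thesis
    proof (cases "a = 0")
      case False
      \<comment> \<open>Any 0-simplex can absorb the excess \<open>2 * k\<close> of the total; the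
        support of \<open>a\<close> supplies one that lies in \<open>X\<close>.\<close>
      then obtain s where "s \<in> Poly_Mapping.keys a" by fastforce
      then have "singular_chain p X (frag_cmul k (frag_of s))"
        using a by (auto simp: singular_chain_def)
      moreover from this have "reduced_cycle p X (a - frag_cmul 2 (frag_cmul k (frag_of s)))"
        using a k 0 unfolding reduced_cycle_def
        by (simp add: singular_chain_diff singular_chain_cmul frag_total_diff frag_total_cmul
            del: frag_cmul_cmul)
      ultimately show ?thesis by blast
    qed (auto intro!: exI[of _ 0] simp: reduced_cycle_def 0)
  next
    case (Suc q)
    then have "reduce2 (chain_boundary p a) = 0"
      using c a by (auto simp: reduced_cycle2_set_def chain2_boundary_reduce2)
    then obtain d where d: "chain_boundary p a = frag_cmul 2 d"
      using reduce2_eq_0_imp_cmul_2 by blast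
    have chain: "singular_chain q X d"
      using singular_chain_boundary[OF a(1)] Suc d by (auto intro: singular_chain_cmulD)
    \<comment> \<open>The chain \<open>2 d\<close> is the boundary of \<open>a\<close>, so its own
      boundary, or its total in degree 0, vanishes; the factor 2 cancels over the integers.\<close>
    have "reduced_cycle q X d"
    proof (cases q)
      case 0
      have "2 * frag_total d = 0"
        using frag_total_chain_boundary[of a] d Suc 0 by (simp flip: frag_total_cmul)
      then show ?thesis using chain 0 by (simp add: reduced_cycle_def)
    next
      case (Suc r)
      have "chain_boundary q (frag_cmul 2 d) = 0"
        using chain_boundary_boundary[OF a(1)] \<open>p = Suc q\<close> d by simp
      then show ?thesis using chain Suc by (simp add: reduced_cycle_def chain_boundary_cmul)
    qed
    then obtain e where "singular_chain p X e" "chain_boundary p e = d"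
      using contractible_reduced_cycle_is_boundary[OF X] Suc by blast
    then show ?thesis
      using a d Suc
      by (auto simp: reduced_cycle_def chain_boundary_diff chain_boundary_cmul
          intro!: exI[of _ e] singular_chain_diff singular_chain_cmul)
  qed
  then obtain e where "reduced_cycle p X (a - frag_cmul 2 e)" by blast
  then show ?thesis
    using a by (auto simp: reduce2_diff simp del: minus_bit_def)
qed

lemma contractible_reduced_cycle2_subset_boundary2:
  assumes "contractible_space X"
  shows "reduced_cycle2_set p X \<subseteq> boundary2_set p X"
proof
  fix c assume "c \<in> reduced_cycle2_set p X"
  then obtain a where a: "reduced_cycle p X a" "reduce2 a = c"
    using reduced_cycle2_lift[OF assms] by blast
  then show "c \<in> boundary2_set p X"
    using contractible_reduced_cycle_is_boundary[OF assms a(1)] by (auto simp: boundary2_set_eq)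
qed

section \<open>Vanishing of the reduced Betti numbers modulo 2\<close>

lemma boundary2_set_0: "0 \<in> boundary2_set p X"
  by (auto simp: boundary2_set_eq intro!: image_eqI[of _ _ 0])

lemma boundary2_set_add:
  "a \<in> boundary2_set p X \<Longrightarrow> b \<in> boundary2_set p X \<Longrightarrow> a + b \<in> boundary2_set p X"
  unfolding boundary2_set_eq image_iff
  by (metis (no_types, lifting) mem_Collect_eq reduce2_add chain_boundary_add singular_chain_add)

lemma chain2_add_self: "c + c = (0 :: 'a chain2)"
proof (rule poly_mapping_eqI)
  show "Poly_Mapping.lookup (c + c) f = Poly_Mapping.lookup 0 f" for f
    by (cases "Poly_Mapping.lookup c f") (simp_all add: lookup_add)
qed

text \<open>The set consisting of the unit alone is dependent, its product being the unit, so only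
  the empty set is independent.\<close>

lemma Z2_dim_trivial:
  assumes "comm_monoid G" "carrier G \<subseteq> {\<one>\<^bsub>G\<^esub>}"
  shows "Z2_dim G = 0"
proof -
  interpret comm_monoid G by fact
  have "C = {}" if "Z2_independent G C" for C
  proof -
    have "C = {} \<or> C = {\<one>\<^bsub>G\<^esub>}"
      using that assms(2) by (auto simp: Z2_independent_def)
    moreover have "finprod G (\<lambda>x. x) {\<one>\<^bsub>G\<^esub>} = \<one>\<^bsub>G\<^esub>"
      by simp
    ultimately show ?thesis
      using that by (auto simp: Z2_independent_def)
  qed
  then have "{enat (card C) | C. Z2_independent G C} \<subseteq> {0}"
    by (force simp: zero_enat_def)
  then show ?thesis
    unfolding Z2_dim_def by (intro antisym Sup_least) auto
qed

theorem reduced_betti2_contractible: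
  assumes "contractible_space X"
  shows "reduced_betti2 i X = 0"
proof -
  let ?B = "boundary2_set i X"
  let ?G = "reduced_homology2_group i X"
  note sub = contractible_reduced_cycle2_subset_boundary2[OF assms, of i]
  \<comment> \<open>The union is the unfolded form of a coset of \<open>?B\<close>. As every cycle
    is a boundary, this covers all cosets that make up the quotient.\<close>
  have coset: "(\<Union>h\<in>?B. {h + a}) = ?B" if "a \<in> ?B" for a
  proof
    show "?B \<subseteq> (\<Union>h\<in>?B. {h + a})"
    proof
      fix b assume "b \<in> ?B"
      then have "b + a \<in> ?B" "b = (b + a) + a"
        using that by (simp_all add: boundary2_set_add add.assoc chain2_add_self)
      then show "b \<in> (\<Union>h\<in>?B. {h + a})" by blast
    qed
  qed (use that boundary2_set_add in auto)
  have one: "\<one>\<^bsub>?G\<^esub> = ?B"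
    by (simp add: reduced_homology2_group_def FactGroup_def)
  have zero: "0 \<in> reduced_cycle2_set i X"
    by (simp add: reduced_cycle2_set_def singular_chain2_set_def chain2_augmentation_def
        chain2_boundary_def)
  have carrier: "carrier ?G = {?B}"
  proof -
    have "carrier ?G = (\<lambda>a. \<Union>h\<in>?B. {h + a}) ` reduced_cycle2_set i X"
      by (auto simp: reduced_homology2_group_def FactGroup_def RCOSETS_def r_coset_def
          reduced_cycle2_group_def)
    also have "\<dots> = (\<lambda>_. ?B) ` reduced_cycle2_set i X"
      using sub coset by (intro image_cong) auto
    finally show ?thesis using zero by auto
  qed
  have mult: "?B \<otimes>\<^bsub>?G\<^esub> ?B = ?B"
  proof -
    have "?B \<otimes>\<^bsub>?G\<^esub> ?B = (\<Union>a\<in>?B. \<Union>h\<in>?B. {h + a})"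
      by (auto simp: reduced_homology2_group_def FactGroup_def set_mult_def
          reduced_cycle2_group_def)
    also have "\<dots> = (\<Union>a\<in>?B. ?B)"
      using coset by (intro SUP_cong) auto
    finally show ?thesis using boundary2_set_0[of i X] by auto
  qed
  have "comm_monoid ?G"
    by (rule comm_monoidI) (simp_all add: carrier one mult)
  then show ?thesis
    unfolding reduced_betti2_def by (rule Z2_dim_trivial) (simp add: carrier one)
qed

section \<open>Caratheodory numbers\<close>

lemma caratheodory_number_le_card:
  assumes "finite F"
  shows "caratheodory_number F \<le> enat (card F)"
  unfolding caratheodory_number_def
proof (rule Inf_lower, rule CollectI, intro exI[of _ "card F"] conjI allI ballI)
  fix S :: "'a set" and x assume x: "x \<in> family_conv F S"
  let ?N = "{A \<in> F. \<not> S \<subseteq> A}"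
  have "\<forall>A\<in>?N. \<exists>s. s \<in> S - A" by blast
  then obtain s where s: "\<And>A. A \<in> ?N \<Longrightarrow> s A \<in> S - A" by metis
  have "card (s ` ?N) \<le> card F"
    using assms by (intro order_trans[OF card_image_le card_mono]) auto
  moreover have "x \<in> family_conv F (s ` ?N)"
    unfolding family_conv_def
  proof (safe)
    fix A assume A: "A \<in> F" "s ` ?N \<subseteq> A"
    \<comment> \<open>Otherwise \<open>A\<close> would be in \<open>?N\<close>, and its own chosen
      point \<open>s A\<close> would lie outside it.\<close>
    then have "S \<subseteq> A"
      using s[of A] by blast
    then show "x \<in> A"
      using x A by (auto simp: family_conv_def)
  qed
  ultimately show "\<exists>S'\<subseteq>S. finite S' \<and> card S' \<le> card F \<and> x \<in> family_conv F S'"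
    using assms s by (intro exI[of _ "s ` ?N"]) auto
qed simp

text \<open>Hulls grow with the set, and a proper subset of \<open>P\<close> lies in some
  \<open>P - {q}\<close>, so it cannot capture \<open>x\<close>. Only \<open>P\<close> itself can
  serve as \<open>S'\<close>.\<close>

lemma caratheodory_number_ge:
  assumes P: "finite P" and x: "x \<in> family_conv F P"
    and proper: "\<And>q. q \<in> P \<Longrightarrow> x \<notin> family_conv F (P - {q})"
  shows "enat (card P) \<le> caratheodory_number F"
  unfolding caratheodory_number_def
proof (rule Inf_greatest, safe)
  fix k
  assume "\<forall>S. \<forall>x\<in>family_conv F S. \<exists>S'\<subseteq>S. finite S' \<and> card S' \<le> k \<and> x \<in> family_conv F S'"
  then obtain S' where S': "S' \<subseteq> P" "card S' \<le> k" "x \<in> family_conv F S'"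
    using x by blast
  have "S' = P"
  proof (rule ccontr)
    assume "S' \<noteq> P"
    then obtain q where "q \<in> P" "S' \<subseteq> P - {q}" using S'(1) by blast
    then show False
      using proper[of q] S'(3) by (auto simp: family_conv_def)
  qed
  then show "enat (card P) \<le> enat k" using S'(2) by simp
qed

theorem theorem7:
  fixes c :: nat
  assumes "c \<ge> 2" and "CARD('d::finite) \<ge> 2"
  shows "\<exists>F :: (real ^ 'd) set set.
           finite F \<and> TC_infinity F = 0 \<and> caratheodory_number F = enat c"
proof -
  obtain m n :: 'd where mn: "m \<noteq> n"
    using assms(2) by (metis card_2_iff' ex_card)
  \<comment> \<open>The coordinate 1 at \<open>m\<close> determines the scalar in any multiple of
    \<open>p j\<close>, and the coordinate \<open>j\<close> at \<open>n\<close> tells the lines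
    apart.\<close>
  define p :: "nat \<Rightarrow> real ^ 'd" where "p j = axis m 1 + real j *\<^sub>R axis n 1" for j
  define A where "A i = {t *\<^sub>R p j | t j. j < c \<and> j \<noteq> i}" for i
  define F where "F = A ` {..<c}"
  have p_m: "p j $ m = 1" and p_n: "p j $ n = real j" for j
    using mn by (auto simp: p_def axis_def)
  have p_in_A: "p j \<in> A i \<longleftrightarrow> j \<noteq> i" if "j < c" for i j
  proof
    assume "p j \<in> A i"
    then obtain t k where tk: "p j = t *\<^sub>R p k" "k \<noteq> i" by (auto simp: A_def)
    have "t = 1"
      using arg_cong[OF tk(1), of "\<lambda>v. v $ m"] by (simp add: p_m)
    then show "j \<noteq> i"
      using arg_cong[OF tk(1), of "\<lambda>v. v $ n"] tk(2) by (simp add: p_n)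
  next
    assume "j \<noteq> i"
    then show "p j \<in> A i"
      using that unfolding A_def by (intro CollectI exI[of _ 1] exI[of _ j]) simp
  qed
  \<comment> \<open>Coordinate 0 at \<open>m\<close> forces the scalar to be 0, but
    \<open>axis n 1\<close> is not the zero vector.\<close>
  have off_lines: "axis n 1 \<notin> A i" for i
  proof
    assume "axis n 1 \<in> A i"
    then obtain t k where tk: "axis n 1 = t *\<^sub>R p k" by (auto simp: A_def)
    have "t = 0"
      using mn arg_cong[OF tk, of "\<lambda>v. v $ m"] by (simp add: p_m axis_def)
    then show False
      using tk by simp
  qed
  have "inj p"
    by (metis injI of_nat_eq_iff p_n)
  define P where "P = p ` {..<c}"
  have P: "finite P" "card P = c"
    using \<open>inj p\<close> by (auto simp: P_def card_image inj_on_subset)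
  have scale: "t *\<^sub>R v \<in> A i" if "v \<in> A i" for t v i
    using that by (fastforce simp: A_def)
  \<comment> \<open>Since \<open>c\<close> is at least 2, some line remains after removing the one
    with index \<open>i\<close>.\<close>
  have zero: "0 \<in> A i" for i
  proof -
    obtain j where "j < c" "j \<noteq> i"
      using assms(1) by (metis less_le_trans one_less_numeral_iff pos2 semiring_norm(76) zero_neq_one)
    then show ?thesis
      using scale[of "p j" i 0] p_in_A by simp
  qed
  have "contractible (\<Inter>G)" if "G \<subseteq> F" for G
  proof (rule starlike_imp_contractible)
    \<comment> \<open>Points of the segment are multiples of \<open>v\<close>, and each
      \<open>A i\<close> is closed under scaling. For empty \<open>G\<close> the intersection is the
      whole space.\<close>
    have "closed_segment 0 v \<subseteq> \<Inter>G" if "v \<in> \<Inter>G" for v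
      using that \<open>G \<subseteq> F\<close> scale by (fastforce simp: closed_segment_def F_def)
    then show "starlike (\<Inter>G)"
      using zero that unfolding starlike_def by (intro bexI[of _ 0]) (auto simp: F_def)
  qed
  then have "reduced_betti2 i (top_of_set (\<Inter>G)) = 0" if "G \<subseteq> F" for G i
    using that by (intro reduced_betti2_contractible) simp
  then have TC: "TC_infinity F = 0"
    unfolding TC_infinity_def by (intro antisym Sup_least) auto
  have "enat (card P) \<le> caratheodory_number F"
  proof (rule caratheodory_number_ge[OF P(1)])
    \<comment> \<open>Each \<open>A i\<close> misses \<open>p i\<close>, so the hull of
      \<open>P\<close> is an intersection over no sets, which is the whole space.\<close>
    have "\<not> P \<subseteq> B" if "B \<in> F" for B
      using that p_in_A by (auto simp: F_def P_def)
    then show "axis n 1 \<in> family_conv F P"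
      by (auto simp: family_conv_def)
  next
    fix q assume "q \<in> P"
    \<comment> \<open>Here \<open>i\<close> is the index with \<open>q = p i\<close>: the remaining
      points all lie on lines kept in \<open>A i\<close>.\<close>
    then obtain i where "i < c" "P - {q} \<subseteq> A i"
      using p_in_A by (auto simp: P_def)
    then show "axis n 1 \<notin> family_conv F (P - {q})"
      using off_lines[of i] by (auto simp: family_conv_def F_def)
  qed
  moreover have "caratheodory_number F \<le> enat c"
  proof -
    have "card F \<le> c"
      unfolding F_def using card_image_le[of "{..<c}" A] by simp
    then show ?thesis
      using caratheodory_number_le_card[of F] by (auto simp: F_def intro: order_trans)
  qed
  ultimately show ?thesis
    using TC P(2) by (intro exI[of _ F]) (auto simp: F_def)
qed

end
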